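(* Let $n$ be a positive integer, let $p,q>1$ satisfy $\frac1p+\frac1q=1$, and let $0<a\le A<\infty$, $0<b\le B<\infty$ be real numbers. Put $C_{\mathbf a,\mathbf b}=\dfrac{A^{q-1}}{b}+\dfrac{B^{p-1}}{a}$. Let $\mathbf a=\{a_k\}_{k=1}^n$ and $\mathbf b=\{b_k\}_{k=1}^n$ be non-increasing sequences of positive real numbers with $a\le a_k\le A$ and $b\le b_k\le B$ for $k=1,\ldots,n$, and such that $\sum_{k=1}^n(-1)^{k+1}a_kb_k\ne 0$. Then $$0\le \frac{\left(\sum_{k=1}^n (-1)^{k+1}a_k^q\right)^{1/q}\left(\sum_{k=1}^n (-1)^{k+1}b_k^p\right)^{1/p}}{\sum_{k=1}^n (-1)^{k+1}a_k b_k}\le C_{\mathbf a,\mathbf b},$$ and $C_{\mathbf a,\mathbf b}\in(1,\infty)$. Moreover, no positive lower bound is available for even $n$: for every even $n\ge 2$ and all $p,q>1$ with $\frac1p+\frac1q=1$, there is no function $c$ (which may depend on $p$ and $q$) assigning to every quadruple of real numbers $(a,A,b,B)$ with $0<a\le A$, $0<b\le B$ a number $c(a,A,b,B)>0$ such that the fraction above is $\ge c(a,A,b,B)$ for all such quadruples and all non-increasing sequences $\mathbf a,\mathbf b$ of length $n$ with $a\le a_k\le A$, $b\le b_k\le B$ $(k=1,\ldots,n)$ and $\sum_{k=1}^n(-1)^{k+1}a_kb_k\ne0$.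
   Context: All sequences consist of real numbers; "non-increasing" means $a_1\ge a_2\ge\cdots\ge a_n$. Sequences for which the denominator of the fraction vanishes are excluded. *)

theory Defs
  imports Complex_Main
begin

definition alt_sum :: "nat \<Rightarrow> (nat \<Rightarrow> real) \<Rightarrow> real" where
  "alt_sum n f = (\<Sum>k=1..n. (-1) ^ (k + 1) * f k)"

text \<open>Sequences of length \<open>n\<close> are functions on \<open>nat\<close> of which only the values at
  \<open>1, \<dots>, n\<close> matter.\<close>

definition noninc_between :: "nat \<Rightarrow> real \<Rightarrow> real \<Rightarrow> (nat \<Rightarrow> real) \<Rightarrow> bool" where
  "noninc_between n l u s \<longleftrightarrow>
     antimono_on {1..n} s \<and> (\<forall>k\<in>{1..n}. l \<le> s k \<and> s k \<le> u)"

text \<open>For non-increasing positive sequences both alternating sums in the numerator are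
  nonnegative, so \<open>powr\<close> is the usual real power there, with \<open>0 powr (1/q) = 0\<close>.
  The value is meaningful only if the denominator is nonzero.\<close>

definition holder_ratio ::
    "nat \<Rightarrow> real \<Rightarrow> real \<Rightarrow> (nat \<Rightarrow> real) \<Rightarrow> (nat \<Rightarrow> real) \<Rightarrow> real" where
  "holder_ratio n p q s t =
     (alt_sum n (\<lambda>k. s k powr q) powr (1 / q) * alt_sum n (\<lambda>k. t k powr p) powr (1 / p))
       / alt_sum n (\<lambda>k. s k * t k)"

definition holder_const :: "real \<Rightarrow> real \<Rightarrow> real \<Rightarrow> real \<Rightarrow> real \<Rightarrow> real \<Rightarrow> real" where
  "holder_const p q a A b B = A powr (q - 1) / b + B powr (p - 1) / a"

end

theory Submission
  imports Defs "HOL-Analysis.Convex"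
begin

text \<open>
  An alternating sum of a non-increasing nonnegative sequence is nonnegative. By the mean value
  theorem the sequence \<open>q A\<^bsup>q-1\<^esup>/b \<cdot> a\<^sub>k b\<^sub>k - a\<^sub>k\<^bsup>q\<^esup>\<close> is of this kind, so the alternating sum of
  \<open>a\<^sub>k\<^bsup>q\<^esup>\<close> is at most \<open>q A\<^bsup>q-1\<^esup>/b\<close> times the denominator, and symmetrically for \<open>b\<^sub>k\<^bsup>p\<^esup>\<close>. Young's
  inequality combines the two estimates. For even \<open>n\<close> a constant sequence \<open>(a\<^sub>k)\<close> makes the fraction
  vanish.
\<close>

text \<open>For odd \<open>n\<close> the last term must stay in the bound: passing to the next,
  even, length subtracts \<open>f (Suc n)\<close>, and this is absorbed by \<open>f n\<close>. In
  the other parity the new term enters with a plus sign.\<close>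

lemma alt_sum_ge:
  assumes "antimono_on {1..n} f"
  shows "(if odd n then f n else 0) \<le> alt_sum n f"
  using assms
proof (induction n)
  case 0
  then show ?case by (simp add: alt_sum_def)
next
  case (Suc n)
  have IH: "(if odd n then f n else 0) \<le> alt_sum n f"
    using Suc.prems by (intro Suc.IH) (auto simp: monotone_on_def)
  have rec: "alt_sum (Suc n) f = alt_sum n f + (-1) ^ n * f (Suc n)"
    by (simp add: alt_sum_def)
  show ?case
  proof (cases "even n")
    case True
    then show ?thesis using IH rec by simp
  next
    case False
    \<comment> \<open>An odd \<open>n\<close> is at least 1, so \<open>n\<close> lies in the range
      on which \<open>f\<close> is monotone.\<close>
    then have "f (Suc n) \<le> f n"
      using Suc.prems by (auto simp: monotone_on_def elim: oddE)
    then show ?thesis using IH rec False by simp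
  qed
qed

lemma alt_sum_nonneg:
  assumes "antimono_on {1..n} f" and "\<And>k. k \<in> {1..n} \<Longrightarrow> 0 \<le> f k"
  shows "0 \<le> alt_sum n f"
  using alt_sum_ge[OF assms(1)] assms(2)[of n] by (cases "odd n") (auto elim: oddE)

lemma alt_sum_linear:
  "alt_sum n (\<lambda>k. c * f k - g k) = c * alt_sum n f - alt_sum n g"
  unfolding alt_sum_def sum_distrib_left sum_subtractf[symmetric]
  by (intro sum.cong) (simp_all add: algebra_simps)

text \<open>The derivative of \<open>z powr r\<close> is nondecreasing for \<open>r \<ge> 1\<close>,
  so the slope at the right endpoint \<open>x\<close> dominates the one from the mean value
  theorem.\<close>

lemma powr_diff_le:
  fixes x y r :: real
  assumes "0 < y" "y \<le> x" "1 \<le> r"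
  shows "x powr r - y powr r \<le> r * x powr (r - 1) * (x - y)"
proof (cases "y = x")
  case False
  with assms have "y < x" by simp
  have "((\<lambda>z. z powr r) has_real_derivative r * z powr (r - 1)) (at z)" if "y \<le> z" for z
    using that assms(1) by (intro has_real_derivative_powr) auto
  with MVT2[OF \<open>y < x\<close>, of "\<lambda>z. z powr r" "\<lambda>z. r * z powr (r - 1)"]
  obtain z where z: "y < z" "z < x" "x powr r - y powr r = (x - y) * (r * z powr (r - 1))"
    by auto
  have "z powr (r - 1) \<le> x powr (r - 1)"
    using z assms by (intro powr_mono2) auto
  then have "(x - y) * (r * z powr (r - 1)) \<le> (x - y) * (r * x powr (r - 1))"
    using assms by (intro mult_left_mono) auto
  then show ?thesis using z(3) by (simp add: mult_ac)
qed simp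

text \<open>The exponent is a free \<open>r\<close> so that one estimate serves both sequences:
  \<open>r = q\<close> as it stands, and \<open>r = p\<close> with their roles exchanged.\<close>

lemma alt_sum_powr_le:
  assumes s: "noninc_between n a A s" and t: "noninc_between n b B t"
    and "0 < a" "0 < b" "1 \<le> r"
  shows "alt_sum n (\<lambda>k. s k powr r) \<le> r * (A powr (r - 1) / b) * alt_sum n (\<lambda>k. s k * t k)"
proof -
  define c where "c = r * (A powr (r - 1) / b)"
  \<comment> \<open>The constant is chosen so that \<open>c * b\<close> bounds the slope of
    \<open>x powr r\<close> for all \<open>x\<close> in \<open>(0, A]\<close>.\<close>
  have cb: "c * b = r * A powr (r - 1)"
    using \<open>0 < b\<close> by (simp add: c_def)
  have c: "0 \<le> c"
    using assms by (simp add: c_def)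
  have s': "a \<le> s k" "s k \<le> A" "b \<le> t k" if "k \<in> {1..n}" for k
    using s t that by (auto simp: noninc_between_def)
  have "0 \<le> alt_sum n (\<lambda>k. c * (s k * t k) - s k powr r)"
  proof (rule alt_sum_nonneg)
    show "antimono_on {1..n} (\<lambda>k. c * (s k * t k) - s k powr r)"
    proof (rule monotone_onI)
      fix i j assume ij: "i \<in> {1..n}" "j \<in> {1..n}" "i \<le> j"
      have st: "s j \<le> s i" "t j \<le> t i"
        using s t ij by (auto simp: noninc_between_def monotone_on_def)
      have "s i powr r - s j powr r \<le> r * s i powr (r - 1) * (s i - s j)"
        using s'(1)[OF ij(2)] st assms by (intro powr_diff_le) auto
      also have "\<dots> \<le> c * b * (s i - s j)"
        unfolding cb using s'[OF ij(1)] st assms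
        by (intro mult_right_mono mult_left_mono powr_mono2) auto
      \<comment> \<open>The bracket is \<open>s i * t i - s j * t j\<close>, split so that
        \<open>t i \<ge> b\<close> controls the first summand and the second is nonnegative.\<close>
      also have "\<dots> \<le> c * ((s i - s j) * t i + s j * (t i - t j))"
      proof -
        have "b * (s i - s j) \<le> t i * (s i - s j)"
          using s'[OF ij(1)] st by (intro mult_right_mono) auto
        moreover have "0 \<le> s j * (t i - t j)"
          using s'[OF ij(2)] st assms by (intro mult_nonneg_nonneg) auto
        ultimately have "b * (s i - s j) \<le> (s i - s j) * t i + s j * (t i - t j)"
          by (simp add: mult.commute)
        then show ?thesis
          using c by (simp add: mult.assoc mult_left_mono)
      qed
      finally show "c * (s j * t j) - s j powr r \<le> c * (s i * t i) - s i powr r"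
        by (simp add: algebra_simps)
    qed
  next
    fix k assume k: "k \<in> {1..n}"
    have pos: "0 < s k"
      using s'[OF k] assms by simp
    \<comment> \<open>With one factor \<open>s k\<close> split off, the remaining power is at most
      \<open>c * b\<close>, and \<open>b \<le> t k\<close> finishes.\<close>
    have "s k powr r = s k powr (r - 1) * s k"
      using pos by (simp add: powr_diff)
    also have "\<dots> \<le> r * A powr (r - 1) * s k"
    proof -
      have "s k powr (r - 1) \<le> A powr (r - 1)"
        using s'[OF k] pos assms by (intro powr_mono2) auto
      also have "\<dots> \<le> r * A powr (r - 1)"
        using mult_right_mono[of 1 r "A powr (r - 1)"] assms by simp
      finally show ?thesis
        using pos by (intro mult_right_mono) auto
    qed
    also have "\<dots> = c * (s k * b)"
      by (simp flip: cb)
    also have "\<dots> \<le> c * (s k * t k)"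
      using c pos s'[OF k] by (intro mult_left_mono) auto
    finally show "0 \<le> c * (s k * t k) - s k powr r"
      by simp
  qed
  then show ?thesis
    unfolding alt_sum_linear c_def[symmetric] by simp
qed

lemma alt_sum_powr_nonneg:
  assumes "noninc_between n a A s" "0 < a" "0 \<le> r"
  shows "0 \<le> alt_sum n (\<lambda>k. s k powr r)"
proof (rule alt_sum_nonneg)
  show "antimono_on {1..n} (\<lambda>k. s k powr r)"
  proof (rule monotone_onI)
    fix i j assume "i \<in> {1..n}" "j \<in> {1..n}" "i \<le> j"
    then have "a \<le> s j" "s j \<le> s i"
      using assms(1) by (auto simp: noninc_between_def monotone_on_def)
    then show "s j powr r \<le> s i powr r"
      using assms(2,3) by (intro powr_mono2) auto
  qed
qed simp

lemma alt_sum_mult_nonneg: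
  assumes "noninc_between n a A s" "noninc_between n b B t" "0 < a" "0 < b"
  shows "0 \<le> alt_sum n (\<lambda>k. s k * t k)"
proof -
  have pos: "0 < s k" "0 < t k" if "k \<in> {1..n}" for k
    using assms that by (force simp: noninc_between_def)+
  show ?thesis
  proof (rule alt_sum_nonneg)
    show "antimono_on {1..n} (\<lambda>k. s k * t k)"
    proof (rule monotone_onI)
      fix i j assume ij: "i \<in> {1..n}" "j \<in> {1..n}" "i \<le> j"
      then show "s j * t j \<le> s i * t i"
        using assms pos[OF ij(1)] pos[OF ij(2)]
        by (intro mult_mono) (auto simp: noninc_between_def monotone_on_def)
    qed
  qed (use pos in \<open>simp add: less_imp_le\<close>)
qed

lemma holder_ratio_bounds:
  assumes pq: "p > 1" "q > 1" "1 / p + 1 / q = 1" and ab: "0 < a" "0 < b"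
    and s: "noninc_between n a A s" and t: "noninc_between n b B t"
    and nz: "alt_sum n (\<lambda>k. s k * t k) \<noteq> 0"
  shows "0 \<le> holder_ratio n p q s t" "holder_ratio n p q s t \<le> holder_const p q a A b B"
proof -
  define X where "X = alt_sum n (\<lambda>k. s k powr q)"
  define Y where "Y = alt_sum n (\<lambda>k. t k powr p)"
  define D where "D = alt_sum n (\<lambda>k. s k * t k)"
  have D: "0 < D"
    using alt_sum_mult_nonneg[OF s t ab] nz by (simp add: D_def)
  have X: "0 \<le> X" "X \<le> q * (A powr (q - 1) / b) * D"
    using alt_sum_powr_nonneg[OF s] alt_sum_powr_le[OF s t ab] pq ab by (simp_all add: X_def D_def)
  have Y: "0 \<le> Y" "Y \<le> p * (B powr (p - 1) / a) * D"
    using alt_sum_powr_nonneg[OF t] alt_sum_powr_le[OF t s ab(2,1)] pq ab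
    by (simp_all add: Y_def D_def mult.commute)
  \<comment> \<open>Young's inequality is applied to the roots, whose powers are again
    \<open>X\<close> and \<open>Y\<close>. The divisors \<open>q\<close> and \<open>p\<close> then
    cancel the factors in the bounds on \<open>X\<close> and \<open>Y\<close>.\<close>
  have "X powr (1 / q) * Y powr (1 / p) \<le> X / q + Y / p"
    using Youngs_inequality[of q p "X powr (1 / q)" "Y powr (1 / p)"] pq X(1) Y(1)
    by (simp add: powr_powr add.commute)
  also have "\<dots> \<le> (A powr (q - 1) / b) * D + (B powr (p - 1) / a) * D"
    using X(2) Y(2) pq by (intro add_mono) (simp_all add: pos_divide_le_eq mult_ac)
  finally have "X powr (1 / q) * Y powr (1 / p) \<le> holder_const p q a A b B * D"
    by (simp add: holder_const_def algebra_simps)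
  then show "holder_ratio n p q s t \<le> holder_const p q a A b B"
    using D by (simp add: holder_ratio_def X_def Y_def D_def pos_divide_le_eq)
  show "0 \<le> holder_ratio n p q s t"
    using D by (simp add: holder_ratio_def D_def)
qed

text \<open>Enlarging the denominators \<open>b\<close> and \<open>a\<close> to \<open>B\<close> and
  \<open>A\<close> can only lower the constant. As \<open>(q - 1) * (p - 1) = 1\<close>, what
  remains is \<open>u + (1 / u) powr (p - 1)\<close>: two positive terms, one of which is at least
  1.\<close>

lemma holder_const_gt_1:
  assumes pq: "p > 1" "q > 1" "1 / p + 1 / q = 1" and "0 < a" "a \<le> A" "0 < b" "b \<le> B"
  shows "1 < holder_const p q a A b B"
proof -
  have conj: "(q - 1) * (p - 1) = 1"
    using pq by (simp add: field_simps)
  define u where "u = A powr (q - 1) / B"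
  have u: "0 < u"
    using assms by (simp add: u_def)
  have "(A powr (q - 1)) powr (p - 1) = A"
    using assms by (simp add: powr_powr conj)
  then have inv: "B powr (p - 1) / A = (1 / u) powr (p - 1)"
    using assms(4-) by (simp add: u_def powr_divide)
  have "1 < u + (1 / u) powr (p - 1)"
  proof (cases "1 < u")
    case False
    then have "1 \<le> (1 / u) powr (p - 1)"
      using u pq by (intro ge_one_powr_ge_zero) auto
    then show ?thesis using u by simp
  qed (simp add: add_pos_nonneg less_le_trans)
  also have "\<dots> \<le> holder_const p q a A b B"
    unfolding holder_const_def inv[symmetric] unfolding u_def
    using assms by (intro add_mono divide_left_mono) auto
  finally show ?thesis .
qed

lemma alt_sum_even_const:
  assumes "even n"
  shows "alt_sum n (\<lambda>k. c) = 0"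
  using assms by (induction n rule: nat_induct2) (auto simp: alt_sum_def)

text \<open>The first factor of the numerator is \<open>0 powr (1 / q) = 0\<close>, whatever
  \<open>t\<close> is.\<close>

lemma holder_ratio_const_eq_0:
  assumes "even n"
  shows "holder_ratio n p q (\<lambda>k. c) t = 0"
  using alt_sum_even_const[OF assms] by (simp add: holder_ratio_def)

text \<open>The sequence is the constant 1, which cancels for even \<open>n\<close>, plus a spike at
  index 1, where the sign is positive. This keeps the denominator of the counterexample
  nonzero.\<close>

lemma alt_sum_bump:
  assumes "even n" "n \<ge> 2"
  shows "alt_sum n (\<lambda>k. if k = 1 then 2 else 1) = 1"
proof -
  have "alt_sum n (\<lambda>k. if k = 1 then 2 else 1) =
      alt_sum n (\<lambda>k. 1) + (\<Sum>k=1..n. if k = 1 then 1 else 0)"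
    unfolding alt_sum_def sum.distrib[symmetric] by (intro sum.cong) auto
  then show ?thesis
    using assms alt_sum_even_const[OF assms(1)] by simp
qed

theorem theorem1:
  fixes n :: nat and p q :: real
  assumes "n \<ge> 1" and "p > 1" and "q > 1" and "1 / p + 1 / q = 1"
  shows "(\<forall>a A b B :: real. 0 < a \<and> a \<le> A \<and> 0 < b \<and> b \<le> B \<longrightarrow>
            (\<forall>s t :: nat \<Rightarrow> real.
               (\<forall>k\<in>{1..n}. 0 < s k \<and> 0 < t k) \<and>
               noninc_between n a A s \<and> noninc_between n b B t \<and>
               alt_sum n (\<lambda>k. s k * t k) \<noteq> 0 \<longrightarrow>
                 0 \<le> holder_ratio n p q s t \<and>
                 holder_ratio n p q s t \<le> holder_const p q a A b B) \<and>
            holder_const p q a A b B \<in> {1<..}) \<and>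
         (even n \<and> n \<ge> 2 \<longrightarrow>
            \<not> (\<exists>c :: real \<Rightarrow> real \<Rightarrow> real \<Rightarrow> real \<Rightarrow> real.
                 \<forall>a A b B :: real. 0 < a \<and> a \<le> A \<and> 0 < b \<and> b \<le> B \<longrightarrow>
                   0 < c a A b B \<and>
                   (\<forall>s t :: nat \<Rightarrow> real.
                      noninc_between n a A s \<and> noninc_between n b B t \<and>
                      alt_sum n (\<lambda>k. s k * t k) \<noteq> 0 \<longrightarrow>
                        c a A b B \<le> holder_ratio n p q s t)))"
proof (intro conjI allI impI)
  fix a A b B :: real and s t :: "nat \<Rightarrow> real"
  assume "0 < a \<and> a \<le> A \<and> 0 < b \<and> b \<le> B"
    and "(\<forall>k\<in>{1..n}. 0 < s k \<and> 0 < t k) \<and> noninc_between n a A s \<and> noninc_between n b B t \<and>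
      alt_sum n (\<lambda>k. s k * t k) \<noteq> 0"
  then show "0 \<le> holder_ratio n p q s t" "holder_ratio n p q s t \<le> holder_const p q a A b B"
    using holder_ratio_bounds[OF assms(2-4)] by blast+
next
  fix a A b B :: real
  assume "0 < a \<and> a \<le> A \<and> 0 < b \<and> b \<le> B"
  then show "holder_const p q a A b B \<in> {1<..}"
    using holder_const_gt_1[OF assms(2-4)] by simp
next
  assume n: "even n \<and> n \<ge> 2"
  define t :: "nat \<Rightarrow> real" where "t = (\<lambda>k. if k = 1 then 2 else 1)"
  have ex: "noninc_between n 1 1 (\<lambda>k. 1)" "noninc_between n 1 2 t" "alt_sum n (\<lambda>k. 1 * t k) \<noteq> 0"
    using alt_sum_bump[of n] n by (auto simp: noninc_between_def monotone_on_def t_def)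
  show "\<not> (\<exists>c :: real \<Rightarrow> real \<Rightarrow> real \<Rightarrow> real \<Rightarrow> real.
                 \<forall>a A b B :: real. 0 < a \<and> a \<le> A \<and> 0 < b \<and> b \<le> B \<longrightarrow>
                   0 < c a A b B \<and>
                   (\<forall>s t :: nat \<Rightarrow> real.
                      noninc_between n a A s \<and> noninc_between n b B t \<and>
                      alt_sum n (\<lambda>k. s k * t k) \<noteq> 0 \<longrightarrow>
                        c a A b B \<le> holder_ratio n p q s t))"
    (is "\<not> (\<exists>c. ?P c)")
  proof
    assume "\<exists>c. ?P c"
    then obtain c :: "real \<Rightarrow> real \<Rightarrow> real \<Rightarrow> real \<Rightarrow> real" where c: "?P c" ..
    \<comment> \<open>Taking \<open>a = A = 1\<close> admits the constant first sequence, while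
      \<open>b = 1\<close> and \<open>B = 2\<close> leave room for the drop in
      \<open>t\<close>.\<close>
    have pos: "0 < c 1 1 1 2"
      and le: "\<And>s t. noninc_between n 1 1 s \<and> noninc_between n 1 2 t \<and>
        alt_sum n (\<lambda>k. s k * t k) \<noteq> 0 \<Longrightarrow> c 1 1 1 2 \<le> holder_ratio n p q s t"
      using c[rule_format, of 1 1 1 2] by auto
    have "c 1 1 1 2 \<le> holder_ratio n p q (\<lambda>k. 1) t"
      by (rule le) (intro conjI ex)
    then show False using pos holder_ratio_const_eq_0 n by simp
  qed
qed

end
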